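(* Let $\mathbb{F}_q$ be a finite field with $q$ elements, let $\ell$ be a prime with $\gcd(\ell,q)=1$, let $s=\nu_\ell(q-1)\ge 1$ be the exponent of the largest power of $\ell$ dividing $q-1$, and assume $s\neq 1$ if $\ell=2$. Fix a primitive $\ell^s$-th root of unity $\mu_s\in\mathbb{F}_q^*$ and put $\mu_j=\mu_s^{\ell^{s-j}}$ for $0\le j\le s$. Let $n\ge 1$, $1\le k\le s$, and $r=\min\{n,s-k\}$. Let $C_k$ be the $\mu_k$-constacyclic code of length $\ell^n$ over $\mathbb{F}_q$ with parity check polynomial $x^{\ell^{n-r}}-\mu_{k+r}$. Then the generator polynomial of $C_k$ is $$g_k(x)=\sum_{i=0}^{\ell^r-1}\mu_{k+r}^{\,i}\,x^{\ell^{n-r}(\ell^r-i-1)},$$ and $$C_k=\left\{(\mathbf{a},\,\mathbf{a}\mu_{k+r},\,\mathbf{a}\mu_{k+r}^2,\,\dots,\,\mathbf{a}\mu_{k+r}^{\ell^r-1}) : \mathbf{a}\in\mathbb{F}_q^{\ell^{n-r}}\right\},$$ where for $\mathbf{a}=(a_0,\dots,a_{\ell^{n-r}-1})$ and $\theta\in\mathbb{F}_q$ we write $\mathbf{a}\theta=(a_0\theta,\dots,a_{\ell^{n-r}-1}\theta)$, and the tuple denotes the concatenation of these $\ell^r$ blocks into a vector of length $\ell^n$.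
   Context: For $\mu\in\mathbb{F}_q^*$ and $m\ge 1$, a linear code $C\subseteq\mathbb{F}_q^m$ is $\mu$-constacyclic if $(c_1,\dots,c_{m-1},\mu c_0)\in C$ whenever $(c_0,\dots,c_{m-1})\in C$. A vector $(a_0,\dots,a_{m-1})$ is identified with the polynomial $a_0x^{m-1}+a_1x^{m-2}+\cdots+a_{m-1}$ modulo $x^m-\mu$; with $\gcd(m,q)=1$, $\mu$-constacyclic codes are the ideals $\langle g(x)\rangle$ of $\mathbb{F}_q[x]/\langle x^m-\mu\rangle$ with $g$ a monic divisor of $x^m-\mu$ (the generator polynomial), and $(x^m-\mu)/g(x)$ is the parity check polynomial. Codewords of $C_k$ are the vectors corresponding to the polynomials $\mathbf{a}(x)g_k(x)$ where $\mathbf{a}(x)=\sum_{j=0}^{\ell^{n-r}-1}a_jx^{\ell^{n-r}-j-1}$. *)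

theory Defs
  imports
    "Jordan_Normal_Form.VS_Connect"
    "HOL-Number_Theory.Cong"
    "HOL-Library.Cardinality"
    "HOL-Computational_Algebra.Polynomial"
begin

definition primitive_root_of_unity :: "nat \<Rightarrow> 'a::field \<Rightarrow> bool" where
  "primitive_root_of_unity N x \<longleftrightarrow> x ^ N = 1 \<and> (\<forall>d. 0 < d \<and> d < N \<longrightarrow> x ^ d \<noteq> 1)"

definition linear_code :: "nat \<Rightarrow> 'a::field vec set \<Rightarrow> bool" where
  "linear_code m C \<longleftrightarrow> VectorSpace.subspace class_ring C (module_vec TYPE('a) m)"

definition constacyclic_shift :: "'a::field \<Rightarrow> 'a vec \<Rightarrow> 'a vec" where
  "constacyclic_shift \<mu> c =
     vec (dim_vec c) (\<lambda>i. if Suc i < dim_vec c then c $ Suc i else \<mu> * c $ 0)"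

definition constacyclic_code :: "'a::field \<Rightarrow> nat \<Rightarrow> 'a vec set \<Rightarrow> bool" where
  "constacyclic_code \<mu> m C \<longleftrightarrow> linear_code m C \<and> (\<forall>c\<in>C. constacyclic_shift \<mu> c \<in> C)"

text \<open>The coordinate with index \<open>0\<close> is the coefficient of the highest power.\<close>

definition vec_poly :: "'a::field vec \<Rightarrow> 'a poly" where
  "vec_poly a = (\<Sum>i<dim_vec a. monom (a $ i) (dim_vec a - 1 - i))"

abbreviation constacyclic_modulus :: "'a::field \<Rightarrow> nat \<Rightarrow> 'a poly" where
  "constacyclic_modulus \<mu> m \<equiv> monom 1 m - [:\<mu>:]"

text \<open>
  Vectors whose polynomial represents an element of the ideal generated by \<open>g\<close> in the
  quotient ring modulo \<open>x ^ m - \<mu>\<close>; the quotient ring is expressed by congruences.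
\<close>

definition ideal_code :: "'a::field \<Rightarrow> nat \<Rightarrow> 'a poly \<Rightarrow> 'a vec set" where
  "ideal_code \<mu> m g =
     {v \<in> carrier_vec m. \<exists>f. [vec_poly v = f * g] (mod constacyclic_modulus \<mu> m)}"

definition is_generator_poly :: "'a::field \<Rightarrow> nat \<Rightarrow> 'a vec set \<Rightarrow> 'a poly \<Rightarrow> bool" where
  "is_generator_poly \<mu> m C g \<longleftrightarrow>
     lead_coeff g = 1 \<and> g dvd constacyclic_modulus \<mu> m \<and> C = ideal_code \<mu> m g"

definition is_parity_check_poly :: "'a::field \<Rightarrow> nat \<Rightarrow> 'a vec set \<Rightarrow> 'a poly \<Rightarrow> bool" where
  "is_parity_check_poly \<mu> m C h \<longleftrightarrow>
     (\<exists>g. is_generator_poly \<mu> m C g \<and> h = constacyclic_modulus \<mu> m div g)"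

text \<open>The concatenation of the \<open>t\<close> blocks \<open>a\<close>, \<open>a\<theta>\<close>, \dots, \<open>a\<theta> ^ (t - 1)\<close>.\<close>

definition scaled_blocks :: "nat \<Rightarrow> 'a::field \<Rightarrow> 'a vec \<Rightarrow> 'a vec" where
  "scaled_blocks t \<theta> a = vec_of_list (concat (map (\<lambda>i. list_of_vec (\<theta> ^ i \<cdot>\<^sub>v a)) [0..<t]))"

text \<open>
  The remaining facts show that generator polynomials are unique and that a monic divisor of
  \<open>x ^ m - \<mu>\<close> is the parity check polynomial of exactly one constacyclic code. By the last fact,
  \<open>x ^ M - \<nu>\<close> is such a divisor when \<open>m = M * t\<close> and \<open>\<mu> = \<nu> ^ t\<close>.
\<close>

lemma coeff_vec_poly:
  assumes "v \<in> carrier_vec m"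
  shows "coeff (vec_poly v) j = (if j < m then v $ (m - 1 - j) else 0)"
proof -
  have d: "dim_vec v = m" using assms by simp
  have "coeff (vec_poly v) j = (\<Sum>i<m. if m - 1 - i = j then v $ i else 0)"
    unfolding vec_poly_def d coeff_sum by simp
  also have "\<dots> = (\<Sum>i<m. if i = m - 1 - j \<and> j < m then v $ i else 0)"
    by (intro sum.cong) auto
  also have "\<dots> = (if j < m then v $ (m - 1 - j) else 0)"
    by (cases "j < m") (auto simp: sum.delta)
  finally show ?thesis .
qed

lemma vec_poly_surj:
  assumes "degree p < m"
  shows "\<exists>v\<in>carrier_vec m. vec_poly v = p"
proof -
  define v where "v = vec m (\<lambda>i. coeff p (m - 1 - i))"
  have v: "v \<in> carrier_vec m" by (simp add: v_def)
  have "vec_poly v = p"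
  proof (rule poly_eqI)
    fix j
    show "coeff (vec_poly v) j = coeff p j"
      unfolding coeff_vec_poly[OF v] using assms by (auto simp: v_def coeff_eq_0)
  qed
  then show ?thesis using v by blast
qed

lemma vec_poly_zero: "vec_poly (0\<^sub>v m) = 0"
  by (rule poly_eqI) (simp add: coeff_vec_poly[of _ m])

lemma vec_poly_add:
  assumes "v \<in> carrier_vec m" "w \<in> carrier_vec m"
  shows "vec_poly (v + w) = vec_poly v + vec_poly w"
  using assms by (intro poly_eqI) (simp add: coeff_vec_poly[of _ m])

lemma vec_poly_smult:
  assumes "v \<in> carrier_vec m"
  shows "vec_poly (c \<cdot>\<^sub>v v) = Polynomial.smult c (vec_poly v)"
  using assms by (intro poly_eqI) (simp add: coeff_vec_poly[of _ m])

lemma vec_poly_shift: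
  assumes v: "v \<in> carrier_vec m" and m: "m > 0"
  shows "vec_poly (constacyclic_shift \<mu> v)
    = pCons 0 (vec_poly v) - Polynomial.smult (v $ 0) (constacyclic_modulus \<mu> m)"
proof (rule poly_eqI)
  fix j
  have w: "constacyclic_shift \<mu> v \<in> carrier_vec m"
    using v by (simp add: constacyclic_shift_def)
  show "coeff (vec_poly (constacyclic_shift \<mu> v)) j =
    coeff (pCons 0 (vec_poly v) - Polynomial.smult (v $ 0) (constacyclic_modulus \<mu> m)) j"
  proof (cases j)
    case 0
    then show ?thesis
      unfolding coeff_vec_poly[OF w] using v m by (auto simp: constacyclic_shift_def)
  next
    case (Suc i)
    have eq: "Suc (m - Suc (Suc i)) = m - Suc i" if "Suc i < m" using that by simp
    show ?thesis
      unfolding coeff_vec_poly[OF w] Suc coeff_diff coeff_pCons_Suc coeff_vec_poly[OF v]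
      using v m eq by (auto simp: constacyclic_shift_def)
  qed
qed

lemma mem_ideal_code_iff:
  assumes "g dvd constacyclic_modulus \<mu> m"
  shows "v \<in> ideal_code \<mu> m g \<longleftrightarrow> v \<in> carrier_vec m \<and> g dvd vec_poly v"
proof -
  have "(\<exists>f. [vec_poly v = f * g] (mod constacyclic_modulus \<mu> m)) \<longleftrightarrow> g dvd vec_poly v"
  proof
    assume "\<exists>f. [vec_poly v = f * g] (mod constacyclic_modulus \<mu> m)"
    then show "g dvd vec_poly v"
      by (metis assms cong_def dvd_mod_iff dvd_triv_right)
  next
    assume "g dvd vec_poly v"
    then show "\<exists>f. [vec_poly v = f * g] (mod constacyclic_modulus \<mu> m)"
      by (metis cong_refl dvd_def mult.commute)
  qed
  then show ?thesis by (simp add: ideal_code_def)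
qed

lemma constacyclic_code_ideal_code:
  assumes g: "g dvd constacyclic_modulus \<mu> m" and m: "m > 0"
  shows "constacyclic_code \<mu> m (ideal_code \<mu> m g)"
  unfolding constacyclic_code_def linear_code_def
proof
  show "VectorSpace.subspace class_ring (ideal_code \<mu> m g) (module_vec TYPE('a) m)"
    unfolding VectorSpace.subspace_def submodule_def
    using vec_vs vec_module
    by (auto simp: module_vec_simps class_ring_simps mem_ideal_code_iff[OF g]
        vec_poly_zero vec_poly_add vec_poly_smult intro: dvd_smult)
  show "\<forall>c\<in>ideal_code \<mu> m g. constacyclic_shift \<mu> c \<in> ideal_code \<mu> m g"
  proof
    fix c assume "c \<in> ideal_code \<mu> m g"
    then have c: "c \<in> carrier_vec m" "g dvd vec_poly c" by (auto simp: mem_ideal_code_iff[OF g])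
    have "g dvd pCons 0 (vec_poly c)"
      using c(2) by (metis dvd_mult mult_pCons_left Polynomial.smult_0_left add_0 mult_1 one_pCons)
    then have "g dvd vec_poly (constacyclic_shift \<mu> c)"
      unfolding vec_poly_shift[OF c(1) m] using g by (metis dvd_diff dvd_smult)
    moreover have "constacyclic_shift \<mu> c \<in> carrier_vec m"
      using c by (simp add: constacyclic_shift_def)
    ultimately show "constacyclic_shift \<mu> c \<in> ideal_code \<mu> m g"
      by (simp add: mem_ideal_code_iff[OF g])
  qed
qed

lemma degree_constacyclic_modulus: "m > 0 \<Longrightarrow> degree (constacyclic_modulus \<mu> m) = m"
  unfolding diff_conv_add_uminus by (subst degree_add_eq_left) (simp_all add: degree_monom_eq)

lemma is_generator_poly_unique:
  assumes "is_generator_poly \<mu> m C g" "is_generator_poly \<mu> m C g'" "m > 0"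
  shows "g = g'"
proof -
  let ?P = "constacyclic_modulus \<mu> m"
  have dvd: "b dvd a" if "is_generator_poly \<mu> m C a" "is_generator_poly \<mu> m C b" for a b
  proof -
    have a: "a dvd ?P" "C = ideal_code \<mu> m a" and b: "b dvd ?P" "C = ideal_code \<mu> m b"
      using that by (auto simp: is_generator_poly_def)
    have "degree (a mod ?P) < m"
      using degree_mod_less[of ?P a] degree_constacyclic_modulus[OF assms(3), of \<mu>] assms(3)
      by (metis degree_0 less_irrefl)
    then obtain v where v: "v \<in> carrier_vec m" "vec_poly v = a mod ?P"
      using vec_poly_surj by blast
    have "v \<in> ideal_code \<mu> m a" using v a(1) by (simp add: mem_ideal_code_iff dvd_mod)
    then have "b dvd a mod ?P" using a b v(2) by (metis mem_ideal_code_iff)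
    then show ?thesis using b(1) by (simp add: dvd_mod_iff)
  qed
  have g0: "g \<noteq> 0" and g0': "g' \<noteq> 0" and lc: "lead_coeff g = 1" "lead_coeff g' = 1"
    using assms(1,2) by (auto simp: is_generator_poly_def)
  obtain c where c: "g = g' * c" using dvd[OF assms(1,2)] by (elim dvdE)
  have c0: "c \<noteq> 0" using c g0 by auto
  have "degree g = degree g' + degree c" using c c0 g0' by (simp add: degree_mult_eq)
  moreover have "degree g \<le> degree g'"
    using dvd[OF assms(2,1)] g0' by (intro dvd_imp_degree_le)
  ultimately have dc: "degree c = 0" by simp
  moreover have "lead_coeff c = 1" using lc c by (simp add: lead_coeff_mult)
  ultimately have "c = 1" by (metis degree_0_id one_pCons)
  then show ?thesis using c by simp
qed

lemma ex1_code_with_parity_check_poly: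
  assumes h: "h dvd constacyclic_modulus \<mu> m" "lead_coeff h = 1" and m: "m > 0"
  shows "\<exists>!C. constacyclic_code \<mu> m C \<and> is_parity_check_poly \<mu> m C h"
proof -
  let ?P = "constacyclic_modulus \<mu> m"
  have P0: "?P \<noteq> 0" using degree_constacyclic_modulus[OF m, of \<mu>] m by (metis degree_0 less_irrefl)
  obtain g where g: "?P = h * g" using h(1) by (elim dvdE)
  have nz: "h \<noteq> 0" "g \<noteq> 0" using g P0 by auto
  have "lead_coeff ?P = 1" using m by (cases m) (simp_all add: degree_constacyclic_modulus)
  then have "lead_coeff g = 1" using h(2) by (simp add: g lead_coeff_mult)
  then have gen: "is_generator_poly \<mu> m (ideal_code \<mu> m g) g"
    using g by (simp add: is_generator_poly_def)
  show ?thesis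
  proof (rule ex1I[of _ "ideal_code \<mu> m g"])
    show "constacyclic_code \<mu> m (ideal_code \<mu> m g) \<and>
        is_parity_check_poly \<mu> m (ideal_code \<mu> m g) h"
      using gen g nz constacyclic_code_ideal_code[of g m \<mu>] m
      by (auto simp: is_parity_check_poly_def intro!: exI[of _ g])
  next
    fix C assume "constacyclic_code \<mu> m C \<and> is_parity_check_poly \<mu> m C h"
    then obtain g' where g': "is_generator_poly \<mu> m C g'" "h = ?P div g'"
      by (auto simp: is_parity_check_poly_def)
    then have "?P = h * g'" by (simp add: is_generator_poly_def)
    then have "g' = g" using g nz by simp
    then show "C = ideal_code \<mu> m g" using g' by (simp add: is_generator_poly_def)
  qed
qed

lemma dvd_constacyclic_modulus_power:
  "monom 1 M - [:\<nu>:] dvd constacyclic_modulus (\<nu> ^ t) (M * t)"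
proof -
  have "monom 1 (M * t) = monom (1::'a) M ^ t" by (simp add: monom_power mult.commute)
  moreover have "[:\<nu> ^ t:] = [:\<nu>:] ^ t" by (simp add: poly_const_pow)
  ultimately show ?thesis by (simp add: power_diff_sumr2)
qed

end

theory Submission
  imports Defs
begin

text \<open>
  Write \<open>M\<close> for the block length, \<open>t\<close> for the number of blocks, \<open>\<nu> = \<mu> (k + r)\<close>, and
  \<open>g = x ^ (M * (t - 1)) + \<nu> x ^ (M * (t - 2)) + \<dots> + \<nu> ^ (t - 1)\<close>. As \<open>\<nu> ^ t = \<mu> k\<close>, the
  geometric sum gives \<open>(x ^ M - \<nu>) * g = x ^ (M * t) - \<mu> k\<close>, so \<open>g\<close> is the generator polynomial.
  Its codewords are the multiples \<open>a g\<close> with \<open>degree a < M\<close>, and multiplying by \<open>g\<close> puts the copy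
  of \<open>a\<close> scaled by \<open>\<nu> ^ i\<close> into the \<open>i\<close>-th block, without overlaps.
\<close>

definition geometric_poly :: "nat \<Rightarrow> nat \<Rightarrow> 'a::field \<Rightarrow> 'a poly" where
  "geometric_poly M t \<nu> = (\<Sum>i<t. monom (\<nu> ^ i) (M * (t - i - 1)))"

lemma geometric_poly_0: "geometric_poly M 0 \<nu> = 0"
  by (simp add: geometric_poly_def)

text \<open>Horner's scheme in \<open>x ^ M\<close>: one more term raises all earlier exponents by
  \<open>M\<close>. The factorization of the modulus and the polynomial of a block vector both
  follow this recursion.\<close>

lemma geometric_poly_Suc:
  "geometric_poly M (Suc t) \<nu> = monom 1 M * geometric_poly M t \<nu> + [:\<nu> ^ t:]"
proof -
  have "(\<Sum>i<t. monom (\<nu> ^ i) (M * (Suc t - i - 1)))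
      = (\<Sum>i<t. monom 1 M * monom (\<nu> ^ i) (M * (t - i - 1)))"
  proof (rule sum.cong[OF refl])
    fix i assume "i \<in> {..<t}"
    then have "Suc t - i - 1 = Suc (t - i - 1)" by auto
    then show "monom (\<nu> ^ i) (M * (Suc t - i - 1)) = monom 1 M * monom (\<nu> ^ i) (M * (t - i - 1))"
      by (simp add: mult_monom)
  qed
  then show ?thesis
    by (simp add: geometric_poly_def sum_distrib_left monom_0)
qed

lemma constacyclic_modulus_eq_geometric:
  "constacyclic_modulus (\<nu> ^ t) (M * t) = (monom 1 M - [:\<nu>:]) * geometric_poly M t \<nu>"
proof (induction t)
  case 0
  show ?case by (simp add: geometric_poly_0 monom_0)
next
  case (Suc t)
  have "(monom 1 M - [:\<nu>:]) * geometric_poly M (Suc t) \<nu>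
      = monom 1 M * constacyclic_modulus (\<nu> ^ t) (M * t) + (monom 1 M - [:\<nu>:]) * [:\<nu> ^ t:]"
    unfolding geometric_poly_Suc Suc.IH by (simp only: algebra_simps)
  \<comment> \<open>The multiples of \<open>x ^ M\<close> by \<open>\<nu> ^ t\<close> in the two
    summands cancel.\<close>
  also have "\<dots> = monom 1 M * monom 1 (M * t) - [:\<nu>:] * [:\<nu> ^ t:]"
    by (simp only: algebra_simps)
  also have "\<dots> = constacyclic_modulus (\<nu> ^ Suc t) (M * Suc t)"
    by (simp add: mult_monom)
  finally show ?case ..
qed

text \<open>Coordinate 0 carries the highest power, so \<open>w\<close> fills the lowest
  coefficients and \<open>v\<close> moves up by the length of \<open>w\<close>.\<close>

lemma vec_poly_append:
  "vec_poly (v @\<^sub>v w) = monom 1 (dim_vec w) * vec_poly v + vec_poly w"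
proof (rule poly_eqI)
  fix j
  have vw: "v @\<^sub>v w \<in> carrier_vec (dim_vec v + dim_vec w)" by simp
  show "coeff (vec_poly (v @\<^sub>v w)) j
      = coeff (monom 1 (dim_vec w) * vec_poly v + vec_poly w) j"
    unfolding coeff_add coeff_vec_poly[OF vw] coeff_vec_poly[OF carrier_vec_dim_vec, of w]
      coeff_monom_mult coeff_vec_poly[OF carrier_vec_dim_vec, of v]
    by (auto intro!: arg_cong[where f = "($) v"] arg_cong[where f = "($) w"])
qed

text \<open>Once the length is fixed, each coordinate can be read off as a coefficient. Without a
  common length, leading zeros would be invisible.\<close>

lemma vec_poly_inj:
  assumes "v \<in> carrier_vec m" "w \<in> carrier_vec m" "vec_poly v = vec_poly w"
  shows "v = w"
proof (rule eq_vecI)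
  show "dim_vec v = dim_vec w" using assms by simp
  fix i assume "i < dim_vec w"
  then have i: "i < m" using assms by simp
  then have "m - 1 - (m - 1 - i) = i" "m - 1 - i < m" by auto
  then show "v $ i = w $ i"
    using coeff_vec_poly[OF assms(1), of "m - 1 - i"] coeff_vec_poly[OF assms(2), of "m - 1 - i"]
      assms(3) by simp
qed

lemma scaled_blocks_0: "scaled_blocks 0 \<theta> a = 0\<^sub>v 0"
  by (rule eq_vecI) (simp_all add: scaled_blocks_def)

lemma vec_of_list_append_list_of_vec:
  "vec_of_list (xs @ list_of_vec w) = vec_of_list xs @\<^sub>v w"
  by (rule eq_vecI) (auto simp: vec_of_list_index nth_append list_of_vec_index)

text \<open>Peeling off the last block rather than the first matches the recursion of
  \<open>geometric_poly\<close>.\<close>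

lemma scaled_blocks_Suc:
  "scaled_blocks (Suc t) \<theta> a = scaled_blocks t \<theta> a @\<^sub>v (\<theta> ^ t \<cdot>\<^sub>v a)"
  by (simp add: scaled_blocks_def vec_of_list_append_list_of_vec del: list_of_vec_append)

lemma dim_scaled_blocks: "dim_vec (scaled_blocks t \<theta> a) = dim_vec a * t"
  by (induction t) (simp_all add: scaled_blocks_0 scaled_blocks_Suc)

text \<open>Appending a block multiplies the polynomial so far by \<open>x ^ M\<close>, where
  \<open>M = dim_vec a\<close>, and adds \<open>\<theta> ^ t\<close> times that of \<open>a\<close>;
  this is the Horner step multiplied by \<open>vec_poly a\<close>.\<close>

lemma vec_poly_scaled_blocks:
  "vec_poly (scaled_blocks t \<theta> a) = vec_poly a * geometric_poly (dim_vec a) t \<theta>"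
proof (induction t)
  case 0
  show ?case unfolding scaled_blocks_0 vec_poly_zero geometric_poly_0 by simp
next
  case (Suc t)
  then show ?case
    by (simp add: scaled_blocks_Suc vec_poly_append geometric_poly_Suc
        vec_poly_smult[OF carrier_vec_dim_vec] algebra_simps)
qed

lemma degree_vec_poly_less:
  assumes "v \<in> carrier_vec m" "m > 0"
  shows "degree (vec_poly v) < m"
proof -
  have "degree (vec_poly v) \<le> m - 1"
    by (rule degree_le) (auto simp: coeff_vec_poly[OF assms(1)])
  then show ?thesis using assms(2) by simp
qed

lemma ideal_code_geometric_poly:
  assumes M: "M > 0" and t: "t > 0"
  shows "ideal_code (\<nu> ^ t) (M * t) (geometric_poly M t \<nu>)
      = {scaled_blocks t \<nu> a | a. a \<in> carrier_vec M}"
proof -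
  let ?g = "geometric_poly M t \<nu>" and ?h = "constacyclic_modulus \<nu> M"
  let ?P = "constacyclic_modulus (\<nu> ^ t) (M * t)"
  have P: "?P = ?h * ?g" by (rule constacyclic_modulus_eq_geometric)
  have Mt: "M * t > 0" using M t by simp
  have degP: "degree ?P = M * t" by (rule degree_constacyclic_modulus[OF Mt])
  have degh: "degree ?h = M" by (rule degree_constacyclic_modulus[OF M])
  have nz: "?g \<noteq> 0" "?h \<noteq> 0" using P degP Mt by auto
  have degg: "M + degree ?g = M * t" using degree_mult_eq[OF nz(2,1)] P degP degh by simp
  have dvd: "?g dvd ?P" unfolding P by simp
  have sb: "scaled_blocks t \<nu> a \<in> carrier_vec (M * t)"
      "vec_poly (scaled_blocks t \<nu> a) = vec_poly a * ?g" if a: "a \<in> carrier_vec M" for a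
  proof -
    have dim: "dim_vec a = M" using a by (rule carrier_vecD)
    show "scaled_blocks t \<nu> a \<in> carrier_vec (M * t)"
      by (rule carrier_vecI) (simp only: dim_scaled_blocks dim)
    show "vec_poly (scaled_blocks t \<nu> a) = vec_poly a * ?g"
      by (simp only: vec_poly_scaled_blocks dim)
  qed
  show ?thesis
  proof (intro Set.set_eqI iffI)
    fix v assume "v \<in> ideal_code (\<nu> ^ t) (M * t) ?g"
    then have v: "v \<in> carrier_vec (M * t)" "?g dvd vec_poly v"
      by (auto simp: mem_ideal_code_iff[OF dvd])
    then obtain f where f: "vec_poly v = ?g * f" by (elim dvdE)
    \<comment> \<open>For nonzero \<open>f\<close>, the degrees of \<open>f\<close> and
      \<open>?g\<close> add up to less than \<open>M * t\<close>, which is \<open>M\<close> plus the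
      degree of \<open>?g\<close>. The zero polynomial has degree 0, below \<open>M\<close> by
      positivity.\<close>
    have "degree f < M"
    proof (cases "f = 0")
      case False
      then show ?thesis
        using degree_vec_poly_less[OF v(1) Mt] degree_mult_eq[OF nz(1) False] degg f by simp
    qed (simp add: M)
    then obtain a where a: "a \<in> carrier_vec M" "vec_poly a = f" using vec_poly_surj by blast
    have "v = scaled_blocks t \<nu> a"
      by (rule vec_poly_inj[OF v(1) sb(1)[OF a(1)]]) (simp add: sb(2)[OF a(1)] a(2) f)
    then show "v \<in> {scaled_blocks t \<nu> a | a. a \<in> carrier_vec M}" using a(1) by blast
  next
    fix v assume "v \<in> {scaled_blocks t \<nu> a | a. a \<in> carrier_vec M}"
    then show "v \<in> ideal_code (\<nu> ^ t) (M * t) ?g"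
      by (auto simp: mem_ideal_code_iff[OF dvd] sb)
  qed
qed

text \<open>A generator divides the modulus, so the division defining the parity check polynomial is
  exact. Both the generator and \<open>geometric_poly\<close> are then cofactors of the nonzero
  \<open>?h\<close> in the same modulus, and \<open>?h\<close> cancels.\<close>

lemma generator_poly_of_binomial_parity_check:
  assumes M: "M > 0" and t: "t > 0"
    and pc: "is_parity_check_poly (\<nu> ^ t) (M * t) C (constacyclic_modulus \<nu> M)"
  shows "is_generator_poly (\<nu> ^ t) (M * t) C (geometric_poly M t \<nu>)"
proof -
  let ?h = "constacyclic_modulus \<nu> M"
  obtain g where g: "is_generator_poly (\<nu> ^ t) (M * t) C g"
    and h: "?h = constacyclic_modulus (\<nu> ^ t) (M * t) div g"
    using pc by (auto simp: is_parity_check_poly_def)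
  have "?h * g = constacyclic_modulus (\<nu> ^ t) (M * t)"
    unfolding h using g by (simp add: is_generator_poly_def)
  then have "?h * g = ?h * geometric_poly M t \<nu>"
    unfolding constacyclic_modulus_eq_geometric .
  moreover have "?h \<noteq> 0"
    using degree_constacyclic_modulus[OF M, of \<nu>] M by (metis degree_0 less_irrefl)
  ultimately show ?thesis using g by simp
qed

theorem theorem4p2:
  fixes l s n k r :: nat
    and \<mu> :: "nat \<Rightarrow> 'a::{field,finite}"
    and C :: "'a vec set"
  assumes "prime l" and "coprime l CARD('a)"
    and "s = multiplicity l (CARD('a) - 1)" and "s \<ge> 1"
    and "l = 2 \<longrightarrow> s \<noteq> 1"
    and "primitive_root_of_unity (l ^ s) (\<mu> s)"
    and "\<forall>j\<le>s. \<mu> j = \<mu> s ^ (l ^ (s - j))"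
    and "n \<ge> 1" and "1 \<le> k" and "k \<le> s"
    and "r = min n (s - k)"
    and "constacyclic_code (\<mu> k) (l ^ n) C"
    and "is_parity_check_poly (\<mu> k) (l ^ n) C (monom 1 (l ^ (n - r)) - [:\<mu> (k + r):])"
  shows "is_generator_poly (\<mu> k) (l ^ n) C
           (\<Sum>i=0..l ^ r - 1. monom (\<mu> (k + r) ^ i) (l ^ (n - r) * (l ^ r - i - 1)))
       \<and> C = {scaled_blocks (l ^ r) (\<mu> (k + r)) a | a. a \<in> carrier_vec (l ^ (n - r))}"
proof -
  define M t \<nu> where "M = l ^ (n - r)" and "t = l ^ r" and "\<nu> = \<mu> (k + r)"
  have pos: "M > 0" "t > 0" using prime_gt_0_nat[OF assms(1)] by (simp_all add: M_def t_def)
  \<comment> \<open>The bound by \<open>s - k\<close> keeps \<open>k + r\<close> in the index range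
    where \<open>\<mu>\<close> is given as a power of \<open>\<mu> s\<close>; the bound by
    \<open>n\<close> makes \<open>M * t\<close> the full length.\<close>
  have r: "r \<le> n" "k + r \<le> s" using assms(10,11) by auto
  have m: "l ^ n = M * t" using r(1) by (simp add: M_def t_def flip: power_add)
  have "\<nu> = \<mu> s ^ (l ^ (s - (k + r)))" using assms(7) r(2) unfolding \<nu>_def by blast
  then have "\<nu> ^ t = \<mu> s ^ (l ^ (s - (k + r)) * l ^ r)"
    by (simp only: t_def power_mult)
  also have "l ^ (s - (k + r)) * l ^ r = l ^ (s - k)" using r(2) by (simp flip: power_add)
  also have "\<mu> s ^ (l ^ (s - k)) = \<mu> k" using assms(7,10) by metis
  finally have \<mu>: "\<mu> k = \<nu> ^ t" ..
  \<comment> \<open>Subtraction truncates at 0, so the two ranges agree only for positive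
    \<open>t\<close>.\<close>
  have "{0..t - 1} = {..<t}" using pos(2) by auto
  then have g: "(\<Sum>i=0..t - 1. monom (\<nu> ^ i) (M * (t - i - 1))) = geometric_poly M t \<nu>"
    by (simp add: geometric_poly_def)
  have gen: "is_generator_poly (\<nu> ^ t) (M * t) C (geometric_poly M t \<nu>)"
    using generator_poly_of_binomial_parity_check[OF pos] assms(13) by (simp only: \<mu> m M_def \<nu>_def)
  then have "C = {scaled_blocks t \<nu> a | a. a \<in> carrier_vec M}"
    by (simp add: is_generator_poly_def ideal_code_geometric_poly[OF pos])
  then show ?thesis
    using gen unfolding \<mu> m g[symmetric] unfolding M_def t_def \<nu>_def by blast
qed

end
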